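(* Let $(\theta^a_t)_{t\ge 0}$ satisfy $\theta^a_t-\theta^a_{t-1}\in\mathcal P$ and $\theta^a_t\in\Omega$ at all times, and let $w_t\in\mathbb W$ for all $t\ge 0$. Consider the finite-horizon robust optimization problem $(\mathrm{RMPC}_t)$ defined in the context, in which the Feasible Parameter Sets $\Theta_t=\{\theta:\mathcal H^\theta_t\theta\le h^\theta_t\}$ are adapted by the recursion given in the context. Suppose $(\mathrm{RMPC}_0)$ is feasible at time step $t=0$ with $\Theta_0=\Omega$. Then $(\mathrm{RMPC}_t)$ remains feasible at all time steps $t\ge 0$, if the state $x_t$ is obtained by applying the closed-loop MPC control law $u_t=v^\star_{t|t}$ (the first auxiliary input of an optimal solution of $(\mathrm{RMPC}_t)$) to the system $x_{t+1}=Ax_t+Bu_t+E\theta^a_t+w_t$, $x_0=x_S$.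
   Context: **System.** $x_{t+1}=Ax_t+Bu_t+E\theta^a_t+w_t$, $x_0=x_S$, with $x_t\in\mathbb R^n$, $u_t\in\mathbb R^m$, known matrices $A$, $B$, $E\in\mathbb R^{n\times p}$. The process noise satisfies $w_t\in\mathbb W=\{w\in\mathbb R^n:-\bar w\le w\le\bar w\}$ (a hyperrectangle containing zero; vector inequalities are componentwise). The offset $\theta^a_t\in\mathbb R^p$ is unknown and time varying, with $\theta^a_t-\theta^a_{t-1}\in\mathcal P=\{\delta\in\mathbb R^p:K^\theta\delta\le l^\theta\}$ (a bounded polytope), and $\theta^a_t\in\Omega=\{\theta:\mathcal H^\theta_0\theta\le h^\theta_0\}$ for all $t\ge0$, where $\Omega$ is a known nonempty polytope containing zero in its interior, and $h^\theta_0\in\mathbb R^{r_0}$. **Constraints.** $\mathbb Z_1=\{(x,u):Cx+Du\le b\}$, with $C\in\mathbb R^{s\times n}$, $D\in\mathbb R^{s\times m}$, $b\in\mathbb R^s$. The constraint set is compact and contains the origin. **Feasible Parameter Sets.** Let $\underline\nu,\bar\nu\in\mathbb R^n$ be the componentwise minimum and maximum of $E\nu$ over $\{\nu:K^\theta\nu\le l^\theta\}$. Set $\Theta_0=\Omega$. Given $\Theta_t=\{\theta:\mathcal H^\theta_t\theta\le h^\theta_t\}$ and the measurement $x_{t+1}$, set $\Theta_{t+1}=\{\theta:\mathcal H^\theta_{t+1}\theta\le h^\theta_{t+1}\}$ with $$\mathcal H^\theta_{t+1}=\begin{bmatrix}\mathcal H^\theta_t \\ -E \\ E\end{bmatrix},\quad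 h^\theta_{t+1}=\begin{bmatrix}h^\theta_t+\Delta h^\theta_t \\ -x_{t+1}+Ax_t+Bu_t+\bar w-\underline\nu \\ x_{t+1}-Ax_t-Bu_t+\bar w+\bar\nu\end{bmatrix},$$ $$\Delta h^\theta_t=[\mathbf 0_{r_0}^\top,-\underline\nu^\top,\bar\nu^\top,\dots,-\underline\nu^\top,\bar\nu^\top]^\top,$$ where the block pair $(-\underline\nu,\bar\nu)$ appears $t$ times. **Predicted Feasible Parameter Sets** (horizon length $N$). $\Theta_{k|t}=\{\theta:\mathcal H^\theta_{k|t}\theta\le h^\theta_{k|t}\}$ with $\Theta_{t|t}=\Theta_t$ (i.e. $\mathcal H^\theta_{t|t}=\mathcal H^\theta_t$, $h^\theta_{t|t}=h^\theta_t$). For $k=t,\dots,t+N-2$: $\mathcal H^\theta_{k+1|t}=\mathcal H^\theta_{k|t}$ and $h^\theta_{k+1|t}=h^\theta_{k|t}+\Delta h^\theta_t$. Terminal condition: $\Theta_{t+N|t}=\Omega$. **Terminal set.** For a fixed linear feedback $u=Kx$, $\mathcal X^R_N=\{x:Y_Rx\le z_R\}$ is the maximal robust positive invariant set, i.e. the maximal set satisfying: $\mathcal X^R_N\subseteq\{x:(x,Kx)\in\mathbb Z_1\}$, and $(A+BK)x+w+E\theta\in\mathcal X^R_N$ for all $x\in\mathcal X^R_N$, $w\in\mathbb W$, $\theta\in\Omega$. **Problem $(\mathrm{RMPC}_t)$.** Given $x_t$, minimize over gains $\mathbf M_t=(M_{k,j|t})_{t\le j<k\le t+N-1}$, $M_{k,j|t}\in\mathbb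 R^{m\times n}$, and auxiliary inputs $\mathbf v_t=(v_{t|t},\dots,v_{t+N-1|t})$, $v_{k|t}\in\mathbb R^m$, the cost $$\sum_{k=t}^{t+N-1}\ell(\bar x_{k|t},v_{k|t})+Q(\bar x_{t+N|t})$$ ($\ell$ and $Q$ positive definite stage and terminal costs), subject to $x_{t|t}=\bar x_{t|t}=x_t$ and, for all $k\in\{t,\dots,t+N-1\}$, - $x_{k+1|t}=Ax_{k|t}+Bu_{k|t}+E\theta_{k|t}+w_{k|t}$, - $\bar x_{k+1|t}=A\bar x_{k|t}+Bv_{k|t}$, - $u_{k|t}=\sum_{j=t}^{k-1}M_{k,j|t}(w_{j|t}+E\theta_{j|t})+v_{k|t}$, - $Cx_{k|t}+Du_{k|t}\le b$, and $x_{t+N|t}\in\mathcal X^R_N$, where all constraints must hold for all $\theta_{k|t}\in\Theta_{k|t}$ and all $w_{k|t}\in\mathbb W$, $k=t,\dots,t+N-1$. Feasible means that some $(\mathbf M_t,\mathbf v_t)$ satisfies all the constraints. *)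

theory Defs
  imports "HOL-Analysis.Analysis"
begin

definition poly_set :: "real^'a^'b \<Rightarrow> real^'b \<Rightarrow> (real^'a) set" where
  "poly_set F g = {z. F *v z \<le> g}"

definition positive_definite :: "('a::zero \<Rightarrow> real) \<Rightarrow> bool" where
  "positive_definite f \<longleftrightarrow> f 0 = 0 \<and> (\<forall>z. z \<noteq> 0 \<longrightarrow> f z > 0)"

text \<open>The index types stand for the dimensions: states \<open>'n\<close>, inputs \<open>'m\<close>, offsets \<open>'p\<close>, and the
  numbers of rows \<open>'s\<close> of the constraints \<open>C x + D u \<le> b\<close>, \<open>'r\<close> of \<open>\<Omega>\<close>, \<open>'q\<close> of the set \<open>\<P>\<close> of offset
  increments, and \<open>'y\<close> of the terminal set.\<close>

record ('n::finite, 'm::finite, 'p::finite, 's::finite, 'r::finite, 'q::finite, 'y::finite) rmpc =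
  matA :: "real^'n^'n"
  matB :: "real^'m^'n"
  matE :: "real^'p^'n"
  wbar :: "real^'n"
  matKtheta :: "real^'p^'q"
  vecltheta :: "real^'q"
  matH0 :: "real^'p^'r"
  vech0 :: "real^'r"
  matC :: "real^'n^'s"
  matD :: "real^'m^'s"
  vecb :: "real^'s"
  gainK :: "real^'n^'m"
  matYR :: "real^'n^'y"
  veczR :: "real^'y"
  stage_cost :: "(real^'n) \<times> (real^'m) \<Rightarrow> real"
  terminal_cost :: "real^'n \<Rightarrow> real"
  horizon :: nat

definition noise_set :: "('n::finite,'m::finite,'p::finite,'s::finite,'r::finite,'q::finite,'y::finite) rmpc
    \<Rightarrow> (real^'n) set" where
  "noise_set S = {w. - wbar S \<le> w \<and> w \<le> wbar S}"

definition drift_set :: "('n::finite,'m::finite,'p::finite,'s::finite,'r::finite,'q::finite,'y::finite) rmpc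
    \<Rightarrow> (real^'p) set" where
  "drift_set S = poly_set (matKtheta S) (vecltheta S)"

definition Omega :: "('n::finite,'m::finite,'p::finite,'s::finite,'r::finite,'q::finite,'y::finite) rmpc
    \<Rightarrow> (real^'p) set" where
  "Omega S = poly_set (matH0 S) (vech0 S)"

definition constraint_set :: "('n::finite,'m::finite,'p::finite,'s::finite,'r::finite,'q::finite,'y::finite) rmpc
    \<Rightarrow> ((real^'n) \<times> (real^'m)) set" where
  "constraint_set S = {(x, u). matC S *v x + matD S *v u \<le> vecb S}"

definition terminal_set :: "('n::finite,'m::finite,'p::finite,'s::finite,'r::finite,'q::finite,'y::finite) rmpc
    \<Rightarrow> (real^'n) set" where
  "terminal_set S = poly_set (matYR S) (veczR S)"

definition robust_invariant :: "('n::finite,'m::finite,'p::finite,'s::finite,'r::finite,'q::finite,'y::finite) rmpc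
    \<Rightarrow> (real^'n) set \<Rightarrow> bool" where
  "robust_invariant S X \<longleftrightarrow>
     X \<subseteq> {x. (x, gainK S *v x) \<in> constraint_set S} \<and>
     (\<forall>x\<in>X. \<forall>w\<in>noise_set S. \<forall>\<theta>\<in>Omega S.
        (matA S + matB S ** gainK S) *v x + w + matE S *v \<theta> \<in> X)"

definition maximal_robust_invariant :: "('n::finite,'m::finite,'p::finite,'s::finite,'r::finite,'q::finite,'y::finite) rmpc
    \<Rightarrow> (real^'n) set \<Rightarrow> bool" where
  "maximal_robust_invariant S X \<longleftrightarrow>
     robust_invariant S X \<and> (\<forall>X'. robust_invariant S X' \<longrightarrow> X' \<subseteq> X)"

text \<open>On the reals, \<open>LEAST\<close> and \<open>GREATEST\<close> denote an attained minimum and maximum. They exist here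
  whenever the set of increments is a nonempty polytope.\<close>

definition nu_low :: "('n::finite,'m::finite,'p::finite,'s::finite,'r::finite,'q::finite,'y::finite) rmpc
    \<Rightarrow> real^'n" where
  "nu_low S = (\<chi> i. LEAST c. \<exists>\<nu>\<in>drift_set S. c = (matE S *v \<nu>) $ i)"

definition nu_high :: "('n::finite,'m::finite,'p::finite,'s::finite,'r::finite,'q::finite,'y::finite) rmpc
    \<Rightarrow> real^'n" where
  "nu_high S = (\<chi> i. GREATEST c. \<exists>\<nu>\<in>drift_set S. c = (matE S *v \<nu>) $ i)"

text \<open>The matrices \<open>H\<^sub>t\<close> and vectors \<open>h\<^sub>t\<close> grow with \<open>t\<close>. They are kept as block matrices and block
  vectors: a first block with the \<open>r\<^sub>0\<close> rows of \<open>\<Omega>\<close>, followed by a list of blocks with \<open>n\<close> rows.\<close>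

type_synonym ('p, 'r, 'n) block_mat = "(real^'p^'r) \<times> (real^'p^'n) list"
type_synonym ('r, 'n) block_vec = "(real^'r) \<times> (real^'n) list"

definition block_add :: "('r::finite,'n::finite) block_vec \<Rightarrow> ('r,'n) block_vec \<Rightarrow> ('r,'n) block_vec" where
  "block_add g h = (fst g + fst h, map2 (+) (snd g) (snd h))"

definition block_poly_set :: "('p::finite,'r::finite,'n::finite) block_mat \<Rightarrow> ('r,'n) block_vec
    \<Rightarrow> (real^'p) set" where
  "block_poly_set H h =
     {\<theta>. fst H *v \<theta> \<le> fst h \<and> list_all2 (\<lambda>F g. F *v \<theta> \<le> g) (snd H) (snd h)}"

primrec fps_mat :: "('n::finite,'m::finite,'p::finite,'s::finite,'r::finite,'q::finite,'y::finite) rmpc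
    \<Rightarrow> nat \<Rightarrow> ('p,'r,'n) block_mat" where
  "fps_mat S 0 = (matH0 S, [])"
| "fps_mat S (Suc t) = (fst (fps_mat S t), snd (fps_mat S t) @ [- matE S, matE S])"

definition delta_h :: "('n::finite,'m::finite,'p::finite,'s::finite,'r::finite,'q::finite,'y::finite) rmpc
    \<Rightarrow> nat \<Rightarrow> ('r,'n) block_vec" where
  "delta_h S t = (0, concat (replicate t [- nu_low S, nu_high S]))"

text \<open>Here \<open>x\<close> and \<open>u\<close> are the measured closed-loop states and inputs. \<open>fps_vec S x u t\<close> depends on
  \<open>x 0, \<dots>, x t\<close> and \<open>u 0, \<dots>, u (t - 1)\<close> only.\<close>

primrec fps_vec :: "('n::finite,'m::finite,'p::finite,'s::finite,'r::finite,'q::finite,'y::finite) rmpc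
    \<Rightarrow> (nat \<Rightarrow> real^'n) \<Rightarrow> (nat \<Rightarrow> real^'m) \<Rightarrow> nat \<Rightarrow> ('r,'n) block_vec" where
  "fps_vec S x u 0 = (vech0 S, [])"
| "fps_vec S x u (Suc t) =
     (let h = block_add (fps_vec S x u t) (delta_h S t)
      in (fst h, snd h @
            [- x (Suc t) + matA S *v x t + matB S *v u t + wbar S - nu_low S,
             x (Suc t) - matA S *v x t - matB S *v u t + wbar S + nu_high S]))"

text \<open>\<open>pred_vec S x u t i\<close> is \<open>h\<close> at prediction time \<open>t + i\<close>, seen from \<open>t\<close>.\<close>

primrec pred_vec :: "('n::finite,'m::finite,'p::finite,'s::finite,'r::finite,'q::finite,'y::finite) rmpc
    \<Rightarrow> (nat \<Rightarrow> real^'n) \<Rightarrow> (nat \<Rightarrow> real^'m) \<Rightarrow> nat \<Rightarrow> nat \<Rightarrow> ('r,'n) block_vec" where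
  "pred_vec S x u t 0 = fps_vec S x u t"
| "pred_vec S x u t (Suc i) = block_add (pred_vec S x u t i) (delta_h S t)"

definition pred_fps :: "('n::finite,'m::finite,'p::finite,'s::finite,'r::finite,'q::finite,'y::finite) rmpc
    \<Rightarrow> (nat \<Rightarrow> real^'n) \<Rightarrow> (nat \<Rightarrow> real^'m) \<Rightarrow> nat \<Rightarrow> nat \<Rightarrow> (real^'p) set" where
  "pred_fps S x u t k =
     (if k = t + horizon S then Omega S
      else block_poly_set (fps_mat S t) (pred_vec S x u t (k - t)))"

text \<open>\<open>traj S xt u d t i\<close> is the state at time \<open>t + i\<close> when the state at time \<open>t\<close> is \<open>xt\<close>, under
  the inputs \<open>u\<close> and the additive disturbances \<open>d\<close> (both indexed by absolute time).\<close>

primrec traj :: "('n::finite,'m::finite,'p::finite,'s::finite,'r::finite,'q::finite,'y::finite) rmpc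
    \<Rightarrow> real^'n \<Rightarrow> (nat \<Rightarrow> real^'m) \<Rightarrow> (nat \<Rightarrow> real^'n) \<Rightarrow> nat \<Rightarrow> nat \<Rightarrow> real^'n" where
  "traj S xt u d t 0 = xt"
| "traj S xt u d t (Suc i) =
     matA S *v traj S xt u d t i + matB S *v u (t + i) + d (t + i)"

definition pred_input :: "(nat \<Rightarrow> nat \<Rightarrow> real^'n^'m) \<Rightarrow> (nat \<Rightarrow> real^'m) \<Rightarrow> (nat \<Rightarrow> real^'n)
    \<Rightarrow> nat \<Rightarrow> nat \<Rightarrow> real^'m" where
  "pred_input M v d t k = (\<Sum>j\<in>{t..<k}. M k j *v d j) + v k"

text \<open>A decision is a pair \<open>(M, v)\<close>, where \<open>M k j\<close> is the gain \<open>M\<^bsub>k,j|t\<^esub>\<close> and \<open>v k\<close> is \<open>v\<^bsub>k|t\<^esub>\<close>. Constraints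
  and cost read only the entries with \<open>t \<le> j < k < t + N\<close> and \<open>t \<le> k < t + N\<close>.\<close>

definition rmpc_admissible :: "('n::finite,'m::finite,'p::finite,'s::finite,'r::finite,'q::finite,'y::finite) rmpc
    \<Rightarrow> (nat \<Rightarrow> real^'n) \<Rightarrow> (nat \<Rightarrow> real^'m) \<Rightarrow> nat
    \<Rightarrow> (nat \<Rightarrow> nat \<Rightarrow> real^'n^'m) \<Rightarrow> (nat \<Rightarrow> real^'m) \<Rightarrow> bool" where
  "rmpc_admissible S x u t M v \<longleftrightarrow>
     (\<forall>\<theta> w. (\<forall>k\<in>{t..<t + horizon S}. \<theta> k \<in> pred_fps S x u t k \<and> w k \<in> noise_set S) \<longrightarrow>
        (let d = (\<lambda>k. w k + matE S *v \<theta> k);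
             up = pred_input M v d t;
             xp = (\<lambda>k. traj S (x t) up d t (k - t))
         in (\<forall>k\<in>{t..<t + horizon S}. matC S *v xp k + matD S *v up k \<le> vecb S) \<and>
            xp (t + horizon S) \<in> terminal_set S))"

definition rmpc_cost :: "('n::finite,'m::finite,'p::finite,'s::finite,'r::finite,'q::finite,'y::finite) rmpc
    \<Rightarrow> (nat \<Rightarrow> real^'n) \<Rightarrow> nat \<Rightarrow> (nat \<Rightarrow> real^'m) \<Rightarrow> real" where
  "rmpc_cost S x t v =
     (let xn = (\<lambda>k. traj S (x t) v (\<lambda>_. 0) t (k - t))
      in (\<Sum>k\<in>{t..<t + horizon S}. stage_cost S (xn k, v k)) + terminal_cost S (xn (t + horizon S)))"

definition rmpc_optimal :: "('n::finite,'m::finite,'p::finite,'s::finite,'r::finite,'q::finite,'y::finite) rmpc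
    \<Rightarrow> (nat \<Rightarrow> real^'n) \<Rightarrow> (nat \<Rightarrow> real^'m) \<Rightarrow> nat
    \<Rightarrow> (nat \<Rightarrow> nat \<Rightarrow> real^'n^'m) \<Rightarrow> (nat \<Rightarrow> real^'m) \<Rightarrow> bool" where
  "rmpc_optimal S x u t M v \<longleftrightarrow>
     rmpc_admissible S x u t M v \<and>
     (\<forall>M' v'. rmpc_admissible S x u t M' v' \<longrightarrow> rmpc_cost S x t v \<le> rmpc_cost S x t v')"

definition rmpc_feasible :: "('n::finite,'m::finite,'p::finite,'s::finite,'r::finite,'q::finite,'y::finite) rmpc
    \<Rightarrow> (nat \<Rightarrow> real^'n) \<Rightarrow> (nat \<Rightarrow> real^'m) \<Rightarrow> nat \<Rightarrow> bool" where
  "rmpc_feasible S x u t \<longleftrightarrow> (\<exists>M v. rmpc_admissible S x u t M v)"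

end

theory Submission
  imports Defs
begin

text \<open>The plan for time \<open>t + 1\<close> replays the plan of time \<open>t\<close>, with the disturbance that actually occurred
  at time \<open>t\<close> (the true offset stays in \<open>\<Theta>\<^sub>t\<close>) absorbed in the auxiliary inputs. The extra last
  input is \<open>K x\<close>, which is again an affine disturbance feedback because the predicted state is an affine
  function of the past disturbances. Robustness is inherited since \<open>\<Theta>\<^bsub>k|t+1\<^esub>\<close> is a subset of \<open>\<Theta>\<^bsub>k|t\<^esub>\<close> and
  of \<open>\<Omega>\<close>, and the terminal set is invariant under \<open>K\<close>.\<close>

section \<open>Block structure and nesting of the predicted parameter sets\<close>

lemma length_delta_h: "length (snd (delta_h S t)) = 2 * t"
  by (induction t) (auto simp: delta_h_def)

lemma snd_delta_h_Suc: "snd (delta_h S (Suc t)) = snd (delta_h S t) @ [- nu_low S, nu_high S]"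
proof -
  have "replicate (Suc t) b = replicate t b @ [b]" for b :: "(real^'a) list"
    by (simp add: replicate_append_same)
  then show ?thesis
    by (simp add: delta_h_def del: replicate_Suc)
qed

lemma length_fps_vec: "length (snd (fps_vec S x u t)) = 2 * t"
  by (induction t) (auto simp: Let_def block_add_def length_delta_h)

lemma length_fps_mat: "length (snd (fps_mat S t)) = 2 * t"
  by (induction t) auto

lemma length_pred_vec: "length (snd (pred_vec S x u t i)) = 2 * t"
  by (induction i) (auto simp: block_add_def length_delta_h length_fps_vec)

lemma fst_fps_vec: "fst (fps_vec S x u t) = vech0 S"
  by (induction t) (auto simp: Let_def block_add_def delta_h_def)

lemma fst_fps_mat: "fst (fps_mat S t) = matH0 S"
  by (induction t) auto

lemma fst_pred_vec: "fst (pred_vec S x u t i) = vech0 S"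
  by (induction i) (auto simp: fst_fps_vec block_add_def delta_h_def)

text \<open>The measurement at \<open>Suc t\<close> only appends rows, and \<open>delta_h\<close> at
  \<open>Suc t\<close> extends \<open>delta_h\<close> at \<open>t\<close>. Hence the old rows
  receive the same increments whether updated or predicted, and only the unnamed tail
  \<open>g\<close> is new.\<close>

lemma snd_pred_vec_Suc: "\<exists>g. snd (pred_vec S x u (Suc t) i) = snd (pred_vec S x u t (Suc i)) @ g"
proof (induction i)
  case 0
  then show ?case by (simp add: Let_def)
next
  case (Suc i)
  then obtain g where g: "snd (pred_vec S x u (Suc t) i) = snd (pred_vec S x u t (Suc i)) @ g"
    by blast
  \<comment> \<open>Equal lengths let \<open>zip\<close> split exactly at the append.\<close>
  have "length (snd (pred_vec S x u t (Suc i))) = length (snd (delta_h S t))"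
    by (simp only: length_pred_vec length_delta_h)
  then have "snd (pred_vec S x u (Suc t) (Suc i)) = snd (pred_vec S x u t (Suc (Suc i)))
      @ map2 (+) g [- nu_low S, nu_high S]"
    unfolding pred_vec.simps(2)[of S x u "Suc t" i] pred_vec.simps(2)[of S x u t "Suc i"]
    by (simp only: block_add_def g snd_delta_h_Suc snd_conv zip_append map_append)
  then show ?case by blast
qed

lemma block_poly_set_pred_vec_Suc:
  "block_poly_set (fps_mat S (Suc t)) (pred_vec S x u (Suc t) i)
     \<subseteq> block_poly_set (fps_mat S t) (pred_vec S x u t (Suc i))"
proof -
  obtain g where g: "snd (pred_vec S x u (Suc t) i) = snd (pred_vec S x u t (Suc i)) @ g"
    using snd_pred_vec_Suc by blast
  have "length (snd (fps_mat S t)) = length (snd (pred_vec S x u t (Suc i)))"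
    by (simp only: length_pred_vec length_fps_mat)
  then show ?thesis
    unfolding block_poly_set_def g fps_mat.simps
    by (auto simp only: fst_pred_vec fst_conv snd_conv list_all2_append)
qed

text \<open>The strict bounds keep both sides out of the \<open>Omega\<close> branch, where the
  inclusion is just that extra rows shrink the set.\<close>

lemma pred_fps_Suc:
  assumes "t < k" "k < t + horizon S"
  shows "pred_fps S x u (Suc t) k \<subseteq> pred_fps S x u t k"
proof -
  have "k - t = Suc (k - Suc t)" using assms by simp
  then show ?thesis
    using block_poly_set_pred_vec_Suc[of S t x u "k - Suc t"] assms
    by (simp add: pred_fps_def del: pred_vec.simps fps_mat.simps)
qed

text \<open>The first block of \<open>delta_h\<close> is zero, so the rows of \<open>Omega\<close>
  are never relaxed.\<close>

lemma pred_fps_subset_Omega: "pred_fps S x u t k \<subseteq> Omega S"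
  by (auto simp: pred_fps_def block_poly_set_def fst_fps_mat fst_pred_vec Omega_def poly_set_def)

section \<open>Drift bounds and membership of the true offset\<close>

lemma compact_attains_Least_Greatest:
  fixes f :: "'a::topological_space \<Rightarrow> real"
  assumes "compact X" "continuous_on X f" "a \<in> X"
  shows "(LEAST c. \<exists>z\<in>X. c = f z) \<le> f a" "f a \<le> (GREATEST c. \<exists>z\<in>X. c = f z)"
proof -
  obtain z where z: "z \<in> X" "\<forall>y\<in>X. f z \<le> f y"
    using continuous_attains_inf[of X f] assms by blast
  have "(LEAST c. \<exists>z\<in>X. c = f z) = f z"
    by (rule Least_equality) (use z in auto)
  then show "(LEAST c. \<exists>z\<in>X. c = f z) \<le> f a" using z assms(3) by simp
  obtain z' where z': "z' \<in> X" "\<forall>y\<in>X. f y \<le> f z'"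
    using continuous_attains_sup[of X f] assms by blast
  have "(GREATEST c. \<exists>z\<in>X. c = f z) = f z'"
    by (rule Greatest_equality) (use z' in auto)
  then show "f a \<le> (GREATEST c. \<exists>z\<in>X. c = f z)" using z' assms(3) by simp
qed

lemma nu_bounds:
  assumes "polytope (drift_set S)" "\<delta> \<in> drift_set S"
  shows "nu_low S \<le> matE S *v \<delta>" "matE S *v \<delta> \<le> nu_high S"
proof -
  have "compact (drift_set S)" using assms(1) polytope_imp_compact by blast
  moreover have "continuous_on (drift_set S) (\<lambda>\<nu>. (matE S *v \<nu>) $ i)" for i
    by (intro continuous_intros linear_continuous_on linear_linear[THEN iffD2] matrix_vector_mul_linear)
  ultimately show "nu_low S \<le> matE S *v \<delta>" "matE S *v \<delta> \<le> nu_high S"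
    using compact_attains_Least_Greatest[of "drift_set S" "\<lambda>\<nu>. (matE S *v \<nu>) $ i" \<delta> for i] assms(2)
    by (auto simp: nu_low_def nu_high_def less_eq_vec_def)
qed

lemma matrix_vector_mult_uminus_left: "(- A) *v z = - (A *v z)" for A :: "real^'a^'b"
  using scaleR_matrix_vector_assoc[of "- 1" A z] by simp

lemma delta_h_covers_drift:
  assumes "polytope (drift_set S)" "\<delta> \<in> drift_set S"
  shows "list_all2 (\<lambda>F g. F *v \<delta> \<le> g) (snd (fps_mat S t)) (snd (delta_h S t))"
proof (induction t)
  case 0
  then show ?case by (simp add: delta_h_def)
next
  case (Suc t)
  then show ?case
    using nu_bounds[OF assms]
    by (auto simp add: snd_delta_h_Suc matrix_vector_mult_uminus_left intro!: list_all2_appendI)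
qed

lemma list_all2_mult_vec_add:
  fixes Fs :: "(real^'a^'b) list"
  assumes "list_all2 (\<lambda>F g. F *v z \<le> g) Fs gs" "list_all2 (\<lambda>F g. F *v z' \<le> g) Fs gs'"
  shows "list_all2 (\<lambda>F g. F *v (z + z') \<le> g) Fs (map2 (+) gs gs')"
  using assms
  by (auto simp: list_all2_conv_all_nth matrix_vector_right_distrib intro!: add_mono)

text \<open>Each update relaxes the old rows just enough to cover one drift step. The two new rows
  hold because the measurement determines the current offset's image under \<open>matE S\<close> up
  to the noise, and one drift step is added to it.\<close>

lemma true_offset_in_fps:
  assumes "polytope (drift_set S)"
    and "\<And>t. \<theta>a (Suc t) - \<theta>a t \<in> drift_set S"
    and "\<And>t. \<theta>a t \<in> Omega S"
    and "\<And>t. w t \<in> noise_set S"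
    and "\<And>t. x (Suc t) = matA S *v x t + matB S *v u t + matE S *v \<theta>a t + w t"
  shows "\<theta>a t \<in> block_poly_set (fps_mat S t) (fps_vec S x u t)"
proof -
  have "list_all2 (\<lambda>F g. F *v \<theta>a t \<le> g) (snd (fps_mat S t)) (snd (fps_vec S x u t))"
  proof (induction t)
    case 0
    then show ?case by simp
  next
    case (Suc t)
    let ?\<delta> = "\<theta>a (Suc t) - \<theta>a t"
    have "list_all2 (\<lambda>F g. F *v (\<theta>a t + ?\<delta>) \<le> g) (snd (fps_mat S t))
        (snd (block_add (fps_vec S x u t) (delta_h S t)))"
      unfolding block_add_def snd_conv
      by (rule list_all2_mult_vec_add[OF Suc delta_h_covers_drift[OF assms(1,2)]])
    moreover have "nu_low S \<le> matE S *v \<theta>a (Suc t) - matE S *v \<theta>a t"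
      "matE S *v \<theta>a (Suc t) - matE S *v \<theta>a t \<le> nu_high S"
      using nu_bounds[OF assms(1,2)] by (auto simp: matrix_vector_mult_diff_distrib)
    moreover have "- wbar S \<le> w t" "w t \<le> wbar S"
      using assms(4)[of t] by (auto simp: noise_set_def)
    moreover from calculation(2-)
    have "- (matE S *v \<theta>a (Suc t)) \<le> - x (Suc t) + matA S *v x t + matB S *v u t + wbar S - nu_low S"
      "matE S *v \<theta>a (Suc t) \<le> x (Suc t) - matA S *v x t - matB S *v u t + wbar S + nu_high S"
      unfolding assms(5) less_eq_vec_def by (simp_all, (smt (verit))+)
    ultimately show ?case
      unfolding fps_mat.simps fps_vec.simps Let_def snd_conv
      by (intro list_all2_appendI) (auto simp: matrix_vector_mult_uminus_left)
  qed
  then show ?thesis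
    using assms(3)[of t]
    by (simp add: block_poly_set_def fst_fps_mat fst_fps_vec Omega_def poly_set_def)
qed

section \<open>Predicted trajectories under affine disturbance feedback\<close>

lemma traj_cong:
  assumes "\<And>k. t \<le> k \<Longrightarrow> k < t + i \<Longrightarrow> u k = u' k" "\<And>k. t \<le> k \<Longrightarrow> k < t + i \<Longrightarrow> d k = d' k"
  shows "traj S z u d t i = traj S z u' d' t i"
  using assms by (induction i) auto

lemma traj_Suc_start:
  "traj S z u d t (Suc i) = traj S (matA S *v z + matB S *v u t + d t) u d (Suc t) i"
  by (induction i) auto

text \<open>The order of quantifiers matters: \<open>G\<close> and \<open>c\<close> do not depend on
  \<open>d\<close>, so they can serve to build gains fixed before the disturbance is known.\<close>

lemma traj_affine:
  "\<exists>G c. \<forall>d. traj S z (pred_input M v d t) d t i = (\<Sum>j\<in>{t..<t + i}. G j *v d j) + c"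
proof (induction i)
  case 0
  then show ?case by auto
next
  case (Suc i)
  then obtain G c
    where G: "\<And>d. traj S z (pred_input M v d t) d t i = (\<Sum>j\<in>{t..<t + i}. G j *v d j) + c"
    by blast
  \<comment> \<open>The newest disturbance enters directly; an older one passes through the state
    and through the feedback gain of the current input.\<close>
  define G' where "G' j = (if j = t + i then mat 1 else matA S ** G j + matB S ** M (t + i) j)" for j
  have "traj S z (pred_input M v d t) d t (Suc i)
      = (\<Sum>j\<in>{t..<t + Suc i}. G' j *v d j) + (matA S *v c + matB S *v v (t + i))" for d
  proof -
    have "(\<Sum>j\<in>{t..<t + i}. G' j *v d j)
        = matA S *v (\<Sum>j\<in>{t..<t + i}. G j *v d j) + matB S *v (\<Sum>j\<in>{t..<t + i}. M (t + i) j *v d j)"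
      unfolding linear_sum[OF matrix_vector_mul_linear] sum.distrib[symmetric]
      by (intro sum.cong)
        (auto simp: G'_def matrix_vector_mult_add_rdistrib matrix_vector_mul_assoc)
    then show ?thesis
      by (simp add: G pred_input_def matrix_vector_right_distrib) (simp add: G'_def)
  qed
  then show ?case by blast
qed

section \<open>The one-step feasibility argument\<close>

lemma rmpc_feasible_Suc:
  assumes "robust_invariant S (terminal_set S)"
    and N: "horizon S \<ge> 1"
    and adm: "rmpc_admissible S x u t M v" and "u t = v t"
    and wt: "wt \<in> noise_set S"
    and \<theta>t: "\<theta>t \<in> block_poly_set (fps_mat S t) (fps_vec S x u t)"
    and x_Suc: "x (Suc t) = matA S *v x t + matB S *v u t + (wt + matE S *v \<theta>t)"
  shows "rmpc_feasible S x u (Suc t)"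
proof -
  obtain n where n: "horizon S = Suc n"
    using N by (cases "horizon S") auto
  define dt where "dt = wt + matE S *v \<theta>t"
  \<comment> \<open>Once \<open>dt\<close> has occurred, its feedback term is a constant
    vector.\<close>
  define v1 where "v1 k = v k + M k t *v dt" for k
  obtain G c where G: "\<And>d. traj S (x (Suc t)) (pred_input M v1 d (Suc t)) d (Suc t) n
      = (\<Sum>j\<in>{Suc t..<Suc t + n}. G j *v d j) + c"
    using traj_affine by blast
  \<comment> \<open>The time \<open>Suc t + n\<close> equals \<open>t + horizon S\<close>, the one
    input time the old plan lacks. \<open>G\<close> and \<open>c\<close> involve only earlier
    inputs, so the definition is not circular.\<close>
  define M' where "M' k j = (if k = Suc t + n then gainK S ** G j else M k j)" for k j
  define v' where "v' k = (if k = Suc t + n then gainK S *v c else v1 k)" for k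
  have "rmpc_admissible S x u (Suc t) M' v'"
    unfolding rmpc_admissible_def Let_def
  proof (intro allI impI)
    fix \<theta> w
    assume "\<forall>k\<in>{Suc t..<Suc t + horizon S}. \<theta> k \<in> pred_fps S x u (Suc t) k \<and> w k \<in> noise_set S"
    then have \<theta>: "\<And>k. Suc t \<le> k \<Longrightarrow> k \<le> Suc t + n \<Longrightarrow> \<theta> k \<in> pred_fps S x u (Suc t) k"
      and w: "\<And>k. Suc t \<le> k \<Longrightarrow> k \<le> Suc t + n \<Longrightarrow> w k \<in> noise_set S"
      by (auto simp: n)
    define d where "d k = w k + matE S *v \<theta> k" for k
    \<comment> \<open>Prepending the realised offset and noise at time \<open>t\<close> turns a
      scenario of the new problem into one allowed in the old problem.\<close>
    define \<theta>0 where "\<theta>0 = \<theta>(t := \<theta>t)"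
    define w0 where "w0 = w(t := wt)"
    define d0 where "d0 k = w0 k + matE S *v \<theta>0 k" for k
    have d0: "d0 t = dt" "\<And>k. k \<noteq> t \<Longrightarrow> d0 k = d k"
      by (auto simp: d0_def d_def dt_def w0_def \<theta>0_def)
    have "\<forall>k\<in>{t..<t + horizon S}. \<theta>0 k \<in> pred_fps S x u t k \<and> w0 k \<in> noise_set S"
    proof
      fix k assume k: "k \<in> {t..<t + horizon S}"
      show "\<theta>0 k \<in> pred_fps S x u t k \<and> w0 k \<in> noise_set S"
      proof (cases "k = t")
        case True
        then show ?thesis
          using wt \<theta>t N by (auto simp: \<theta>0_def w0_def pred_fps_def)
      next
        case False
        then show ?thesis
          using k \<theta>[of k] w[of k] pred_fps_Suc[of t k S x u] by (auto simp: \<theta>0_def w0_def n)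
      qed
    qed
    then have old: "\<And>k. t \<le> k \<Longrightarrow> k < t + horizon S \<Longrightarrow>
          matC S *v traj S (x t) (pred_input M v d0 t) d0 t (k - t)
            + matD S *v pred_input M v d0 t k \<le> vecb S"
      "traj S (x t) (pred_input M v d0 t) d0 t (Suc n) \<in> terminal_set S"
      using adm unfolding rmpc_admissible_def Let_def d0_def[abs_def] by (auto simp: n)
    let ?u = "pred_input M' v' d (Suc t)"
    have input: "pred_input M v d0 t k = pred_input M v1 d (Suc t) k" if "t < k" for k
    proof -
      have "pred_input M v d0 t k = M k t *v d0 t + (\<Sum>j\<in>{Suc t..<k}. M k j *v d0 j) + v k"
        using that by (simp add: pred_input_def sum.atLeast_Suc_lessThan)
      also have "(\<Sum>j\<in>{Suc t..<k}. M k j *v d0 j) = (\<Sum>j\<in>{Suc t..<k}. M k j *v d j)"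
        by (intro sum.cong) (auto simp: d0)
      finally show ?thesis by (simp add: pred_input_def v1_def d0)
    qed
    have input': "?u k = pred_input M v1 d (Suc t) k" if "k < Suc t + n" for k
      using that by (simp add: pred_input_def M'_def v'_def)
    have state': "traj S (x (Suc t)) ?u d (Suc t) i
        = traj S (x (Suc t)) (pred_input M v1 d (Suc t)) d (Suc t) i" if "i \<le> n" for i
      by (rule traj_cong) (use that input' in auto)
    have state: "traj S (x (Suc t)) ?u d (Suc t) i = traj S (x t) (pred_input M v d0 t) d0 t (Suc i)"
      if "i \<le> n" for i
    proof -
      \<comment> \<open>At time \<open>t\<close> the feedback sum is empty, so the first predicted
        input is the applied \<open>v t\<close>, and the old prediction passes through the measured
        \<open>x (Suc t)\<close>.\<close>
      have "x (Suc t) = matA S *v x t + matB S *v pred_input M v d0 t t + d0 t"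
        using x_Suc \<open>u t = v t\<close> by (simp add: pred_input_def d0 dt_def)
      then show ?thesis
        unfolding state'[OF that] traj_Suc_start
        by (auto intro!: traj_cong simp: input d0)
    qed
    let ?z = "traj S (x (Suc t)) ?u d (Suc t) n"
    have z: "?z \<in> terminal_set S"
      using old(2) state by simp
    have uz: "?u (Suc t + n) = gainK S *v ?z"
      unfolding state'[OF order_refl] G
      by (simp add: pred_input_def M'_def v'_def matrix_vector_right_distrib
          matrix_vector_mul_assoc linear_sum[OF matrix_vector_mul_linear])
    have cons: "matC S *v traj S (x (Suc t)) ?u d (Suc t) (k - Suc t) + matD S *v ?u k \<le> vecb S"
      if k: "k \<in> {Suc t..<Suc t + horizon S}" for k
    proof (cases "k = Suc t + n")
      case True
      have "(?z, gainK S *v ?z) \<in> constraint_set S"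
        using assms(1) z by (auto simp: robust_invariant_def)
      then show ?thesis
        using True uz by (simp add: constraint_set_def)
    next
      case False
      then have "k < Suc t + n" "k - t = Suc (k - Suc t)" "t \<le> k" "t < k" "k < t + horizon S"
        using k n by auto
      then show ?thesis
        using old(1)[of k] state[of "k - Suc t"] input[of k] input'[of k] by simp
    qed
    \<comment> \<open>At the appended step the old plan gives no guarantee. Invariance takes over,
      and it covers only offsets in \<open>Omega S\<close>.\<close>
    have "\<theta> (Suc t + n) \<in> Omega S"
      using \<theta>[of "Suc t + n"] pred_fps_subset_Omega by fastforce
    then have "(matA S + matB S ** gainK S) *v ?z + w (Suc t + n) + matE S *v \<theta> (Suc t + n)
        \<in> terminal_set S"
      using assms(1) z w[of "Suc t + n"] by (auto simp: robust_invariant_def)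
    then have "traj S (x (Suc t)) ?u d (Suc t) (horizon S) \<in> terminal_set S"
      using uz by (simp add: n d_def matrix_vector_mult_add_rdistrib matrix_vector_mul_assoc add.assoc)
    then show "(\<forall>k\<in>{Suc t..<Suc t + horizon S}.
          matC S *v traj S (x (Suc t)) (pred_input M' v' (\<lambda>k. w k + matE S *v \<theta> k) (Suc t))
              (\<lambda>k. w k + matE S *v \<theta> k) (Suc t) (k - Suc t)
            + matD S *v pred_input M' v' (\<lambda>k. w k + matE S *v \<theta> k) (Suc t) k \<le> vecb S)
        \<and> traj S (x (Suc t)) (pred_input M' v' (\<lambda>k. w k + matE S *v \<theta> k) (Suc t))
              (\<lambda>k. w k + matE S *v \<theta> k) (Suc t) (Suc t + horizon S - Suc t) \<in> terminal_set S"
      using cons by (simp add: d_def[abs_def])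
  qed
  then show ?thesis
    by (auto simp: rmpc_feasible_def)
qed

theorem theorem1:
  fixes S :: "('n::finite,'m::finite,'p::finite,'s::finite,'r::finite,'q::finite,'y::finite) rmpc"
    and x\<^sub>S :: "real^'n"
    and x w :: "nat \<Rightarrow> real^'n"
    and u :: "nat \<Rightarrow> real^'m"
    and \<theta>a :: "nat \<Rightarrow> real^'p"
  assumes "horizon S \<ge> 1"
    and "0 \<le> wbar S"
    and "polytope (drift_set S)"
    and "polytope (Omega S)" and "0 \<in> interior (Omega S)"
    and "compact (constraint_set S)" and "(0, 0) \<in> constraint_set S"
    and "maximal_robust_invariant S (terminal_set S)"
    and "positive_definite (stage_cost S)" and "positive_definite (terminal_cost S)"
    and "\<And>t. \<theta>a (Suc t) - \<theta>a t \<in> drift_set S"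
    and "\<And>t. \<theta>a t \<in> Omega S"
    and "\<And>t. w t \<in> noise_set S"
    and "x 0 = x\<^sub>S"
    and "\<And>t. x (Suc t) = matA S *v x t + matB S *v u t + matE S *v \<theta>a t + w t"
    and "\<And>t. rmpc_feasible S x u t \<Longrightarrow> \<exists>M v. rmpc_optimal S x u t M v \<and> u t = v t"
    and "rmpc_feasible S x u 0"
  shows "\<forall>t. rmpc_feasible S x u t"
proof
  fix t
  have rpi: "robust_invariant S (terminal_set S)"
    using assms(8) by (simp add: maximal_robust_invariant_def)
  show "rmpc_feasible S x u t"
  proof (induction t)
    case 0
    then show ?case using assms(17) .
  next
    case (Suc t)
    \<comment> \<open>Feasibility at \<open>t\<close> makes the control law defined; the optimal
      pair is in particular admissible, and its first auxiliary input is \<open>u t\<close>.\<close>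
    obtain M v where "rmpc_optimal S x u t M v" "u t = v t"
      using assms(16)[OF Suc] by blast
    moreover have "\<theta>a t \<in> block_poly_set (fps_mat S t) (fps_vec S x u t)"
      by (rule true_offset_in_fps[where w = w]) (use assms in auto)
    ultimately show ?case
      using rmpc_feasible_Suc[OF rpi assms(1) _ _ assms(13)[of t]]
      by (auto simp: rmpc_optimal_def assms(15)[of t] algebra_simps)
  qed
qed

end
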